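(* For every $n\ge1$ and every graph $G$ that is a subgraph of some $G'\in PW_2(n)$, the convex geometric Ramsey number satisfies $R_c(G)\le 20n^7$.
   Context: $PW_2(n)$ is the class of outerplanar triangulations $G$ on $n$ vertices (planar graphs drawable with all vertices on the outer face and every bounded face a triangle) whose vertex set can be partitioned into two sets inducing paths; equivalently, the outerplanar triangulations on $n$ vertices of pathwidth at most $2$. For a point set $P$, $K_P$ is the complete graph on $P$ with straight-segment edges. A monochromatic non-crossing copy of $G$ in a $2$-colouring of $K_P$ is an injective map $\phi:V(G)\to P$ such that all segments $\phi(x)\phi(y)$, $xy\in E(G)$, have the same colour and no two share a point other than a common endpoint. $R_c(G)$ is the smallest $N$ such that for every set $P$ of $N$ points in convex position (vertex set of a convex polygon), every $2$-colouring of the edges of $K_P$ contains a monochromatic non-crossing copy of $G$. *)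

theory Defs
  imports "HOL-Analysis.Analysis" "HOL-Library.Extended_Nat"
begin

type_synonym point = "real \<times> real"

definition simple_graph :: "'v set \<Rightarrow> 'v set set \<Rightarrow> bool" where
  "simple_graph V E \<longleftrightarrow> finite V \<and>
     (\<forall>e\<in>E. \<exists>x y. x \<noteq> y \<and> x \<in> V \<and> y \<in> V \<and> e = {x, y})"

definition convex_position :: "point set \<Rightarrow> bool" where
  "convex_position P \<longleftrightarrow> finite P \<and> (\<forall>p\<in>P. p \<notin> convex hull (P - {p}))"

definition noncrossing_embedding :: "('v \<Rightarrow> point) \<Rightarrow> 'v set \<Rightarrow> 'v set set \<Rightarrow> bool" where
  "noncrossing_embedding \<phi> V E \<longleftrightarrow> inj_on \<phi> V \<and>
     (\<forall>x y u w. {x, y} \<in> E \<longrightarrow> {u, w} \<in> E \<longrightarrow> {x, y} \<noteq> {u, w} \<longrightarrow>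
        closed_segment (\<phi> x) (\<phi> y) \<inter> closed_segment (\<phi> u) (\<phi> w) \<subseteq> \<phi> ` ({x, y} \<inter> {u, w}))"

text \<open>Outerplanar triangulation (maximal outerplanar graph): drawable with vertices in
  convex position, straight non-crossing edges, such that no further edge can be added
  to the drawing without crossing (i.e. the drawing triangulates the convex polygon).\<close>
definition outerplanar_triangulation :: "'v set \<Rightarrow> 'v set set \<Rightarrow> bool" where
  "outerplanar_triangulation V E \<longleftrightarrow> simple_graph V E \<and>
     (\<exists>\<phi>. convex_position (\<phi> ` V) \<and> noncrossing_embedding \<phi> V E \<and>
        (\<forall>x\<in>V. \<forall>y\<in>V. x \<noteq> y \<longrightarrow> {x, y} \<notin> E \<longrightarrow>
            \<not> noncrossing_embedding \<phi> V (insert {x, y} E)))"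

definition induces_path :: "'v set set \<Rightarrow> 'v set \<Rightarrow> bool" where
  "induces_path E S \<longleftrightarrow> (\<exists>xs. xs \<noteq> [] \<and> distinct xs \<and> set xs = S \<and>
     (\<forall>i<length xs. \<forall>j<length xs. {xs ! i, xs ! j} \<in> E \<longleftrightarrow> (i = Suc j \<or> j = Suc i)))"

text \<open>PW_2(n): outerplanar triangulations on n vertices whose vertex set splits into two
  parts each inducing a path (a part may be empty, relevant only for n = 1).\<close>
definition PW2 :: "nat \<Rightarrow> 'v set \<Rightarrow> 'v set set \<Rightarrow> bool" where
  "PW2 n V E \<longleftrightarrow> outerplanar_triangulation V E \<and> card V = n \<and>
     (\<exists>A B. A \<union> B = V \<and> A \<inter> B = {} \<and>
        (A = {} \<or> induces_path E A) \<and> (B = {} \<or> induces_path E B))"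

definition subgraph_of :: "'v set \<Rightarrow> 'v set set \<Rightarrow> 'w set \<Rightarrow> 'w set set \<Rightarrow> bool" where
  "subgraph_of V E V' E' \<longleftrightarrow> (\<exists>f. inj_on f V \<and> f ` V \<subseteq> V' \<and> (\<forall>e\<in>E. f ` e \<in> E'))"

definition mono_noncrossing_copy ::
    "'v set \<Rightarrow> 'v set set \<Rightarrow> point set \<Rightarrow> (point set \<Rightarrow> bool) \<Rightarrow> bool" where
  "mono_noncrossing_copy V E P c \<longleftrightarrow> (\<exists>\<phi> col. \<phi> ` V \<subseteq> P \<and> noncrossing_embedding \<phi> V E \<and>
     (\<forall>e\<in>E. c (\<phi> ` e) = col))"

definition convex_ramsey_prop :: "'v set \<Rightarrow> 'v set set \<Rightarrow> nat \<Rightarrow> bool" where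
  "convex_ramsey_prop V E N \<longleftrightarrow> (\<forall>P c. convex_position P \<longrightarrow> card P = N \<longrightarrow>
     mono_noncrossing_copy V E P c)"

text \<open>R_c(G), infinite if no such N exists.\<close>
definition convex_ramsey :: "'v set \<Rightarrow> 'v set set \<Rightarrow> enat" where
  "convex_ramsey V E = (INF N\<in>{N. convex_ramsey_prop V E N}. enat N)"

end

theory Submission
  imports Defs
begin

text \<open>After a rotation of the cyclic order, the two induced paths of a graph in \<open>PW\<^sub>2(n)\<close> occupy
  complementary arcs, their edges are sides of the polygon, and the edges between them form a chain
  in the product order. Such a chain extends to a staircase, so the graph lies in a triangulated
  strip that grows one vertex at a time, on one side or the other.

  Split \<open>4 n\<^sup>2\<close> convex points into two arcs. Label each edge between the arcs by its colour and by the
  length of the longest prefix of the strip that embeds in this colour with this edge as last edge.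
  If two edges with a common end have the same label, and the strip next grows at the other end,
  then their two other ends are joined in the opposite colour, since otherwise the prefix could be
  extended. So either the whole strip embeds, or by pigeonhole one label occurs often enough at a
  single vertex to give a monochromatic clique on \<open>n\<close> points, which contains every such graph.
  This gives the bound \<open>4 n\<^sup>2\<close>.\<close>

section \<open>Cyclic order of points in convex position\<close>

definition det3 :: "point \<Rightarrow> point \<Rightarrow> point \<Rightarrow> real" where
  "det3 a b c = (fst b - fst a) * (snd c - snd a) - (snd b - snd a) * (fst c - fst a)"

text \<open>\<open>det3\<close> is twice the signed area of a triangle, so for at least three points
  the indices run counterclockwise around a strictly convex polygon.\<close>

definition ccw_order :: "nat \<Rightarrow> (nat \<Rightarrow> point) \<Rightarrow> bool" where
  "ccw_order N p \<longleftrightarrow> (\<forall>i j k. i < j \<longrightarrow> j < k \<longrightarrow> k < N \<longrightarrow> det3 (p i) (p j) (p k) > 0)"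

lemma det3_rotate: "det3 a b c = det3 b c a"
  by (simp add: det3_def algebra_simps)

lemma det3_swap: "det3 a c b = - det3 a b c"
  by (simp add: det3_def algebra_simps)

lemma det3_same [simp]: "det3 a b a = 0" "det3 a b b = 0"
  by (simp_all add: det3_def)

lemma det3_affine:
  assumes "u + v = 1"
  shows "det3 a b (u *\<^sub>R c + v *\<^sub>R d) = u * det3 a b c + v * det3 a b d"
proof -
  have u: "u = 1 - v" using assms by simp
  show ?thesis by (simp add: det3_def u algebra_simps)
qed

text \<open>The three determinants that contain \<open>x\<close>, divided by
  \<open>det3 a b c\<close>, are the barycentric coordinates of \<open>x\<close>.\<close>

lemma in_triangle:
  assumes "det3 a b c > 0" "det3 a b x \<ge> 0" "det3 b c x \<ge> 0" "det3 c a x \<ge> 0"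
  shows "x \<in> convex hull {a, b, c}"
proof -
  define D where "D = det3 a b c"
  have D: "D > 0" using assms(1) by (simp add: D_def)
  define u v w where "u = det3 b c x / D" and "v = det3 c a x / D" and "w = det3 a b x / D"
  have nn: "u \<ge> 0" "v \<ge> 0" "w \<ge> 0"
    using assms D by (auto simp: u_def v_def w_def)
  have "det3 b c x + det3 c a x + det3 a b x = D"
    by (simp add: D_def det3_def algebra_simps)
  hence s: "u + v + w = 1"
    using D unfolding u_def v_def w_def by (simp add: add_divide_distrib[symmetric])
  have 1: "D * fst x = det3 b c x * fst a + det3 c a x * fst b + det3 a b x * fst c"
    by (simp add: D_def det3_def algebra_simps)
  have 2: "D * snd x = det3 b c x * snd a + det3 c a x * snd b + det3 a b x * snd c"
    by (simp add: D_def det3_def algebra_simps)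
  have "fst x = u * fst a + v * fst b + w * fst c" "snd x = u * snd a + v * snd b + w * snd c"
    using 1 2 D by (simp_all add: u_def v_def w_def field_simps)
  hence "x = u *\<^sub>R a + v *\<^sub>R b + w *\<^sub>R c"
    by (simp add: prod_eq_iff)
  thus ?thesis using nn s unfolding convex_hull_3 by blast
qed

text \<open>The affine function \<open>det3 a b\<close> vanishes on the segment from
  \<open>a\<close> to \<open>b\<close>. Along the segment from \<open>c\<close> to \<open>d\<close>
  it is nonnegative at both ends and not zero at both, so it can vanish only at an end.\<close>

lemma segment_side_inter:
  assumes "det3 a b c \<ge> 0" "det3 a b d \<ge> 0" "det3 a b c + det3 a b d > 0"
    "x \<in> closed_segment a b" "x \<in> closed_segment c d"
  shows "(x = c \<and> det3 a b c = 0) \<or> (x = d \<and> det3 a b d = 0)"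
proof -
  obtain t where t: "x = (1 - t) *\<^sub>R a + t *\<^sub>R b" "0 \<le> t" "t \<le> 1"
    using assms(4) unfolding closed_segment_def by blast
  obtain r where r: "x = (1 - r) *\<^sub>R c + r *\<^sub>R d" "0 \<le> r" "r \<le> 1"
    using assms(5) unfolding closed_segment_def by blast
  have "det3 a b x = 0" unfolding t(1) by (subst det3_affine) auto
  moreover have "det3 a b x = (1 - r) * det3 a b c + r * det3 a b d"
    unfolding r(1) by (subst det3_affine) auto
  moreover have "(1 - r) * det3 a b c \<ge> 0" "r * det3 a b d \<ge> 0" using assms r by auto
  ultimately have "(1 - r) * det3 a b c = 0" "r * det3 a b d = 0" by linarith+
  hence "(r = 1 \<or> det3 a b c = 0) \<and> (r = 0 \<or> det3 a b d = 0)" by auto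
  thus ?thesis using assms(3) r by auto
qed

lemma segment_side_inter':
  assumes "det3 a b c \<le> 0" "det3 a b d \<le> 0" "det3 a b c + det3 a b d < 0"
    "x \<in> closed_segment a b" "x \<in> closed_segment c d"
  shows "(x = c \<and> det3 a b c = 0) \<or> (x = d \<and> det3 a b d = 0)"
proof -
  have "det3 b a z = - det3 a b z" for z by (simp add: det3_def algebra_simps)
  thus ?thesis using segment_side_inter[of b a c d x] assms by (auto simp: closed_segment_commute)
qed

text \<open>The common point is computed explicitly: \<open>D\<close> is twice the area of the
  quadrilateral, obtained by cutting along either diagonal, and \<open>t\<close> and
  \<open>r\<close> are ratios of triangle areas to the whole.\<close>

lemma diagonals_meet:
  assumes "det3 a b c > 0" "det3 a b d > 0" "det3 a c d > 0" "det3 b c d > 0"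
  shows "closed_segment a c \<inter> closed_segment b d \<noteq> {}"
proof -
  define D where "D = det3 a b c + det3 a c d"
  define t where "t = det3 a b d / D"
  define r where "r = det3 a b c / D"
  have D: "D > 0" using assms by (simp add: D_def)
  have DD: "D = det3 a b d + det3 b c d"
    by (simp add: D_def det3_def algebra_simps)
  have tr: "0 \<le> t" "t \<le> 1" "0 \<le> r" "r \<le> 1"
    using assms D unfolding t_def r_def by (auto simp: DD) (auto simp: DD[symmetric] D_def)
  have t: "D * t = det3 a b d" and r: "D * r = det3 a b c"
    using D by (auto simp: t_def r_def)
  have "D * ((1 - t) * fst a + t * fst c) = D * ((1 - r) * fst b + r * fst d)"
  proof -
    have "D * ((1 - t) * fst a + t * fst c) = D * fst a + (D * t) * (fst c - fst a)"
      by (simp add: algebra_simps)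
    also have "\<dots> = D * fst b + (D * r) * (fst d - fst b)"
      unfolding t r unfolding D_def det3_def by (simp add: algebra_simps)
    finally show ?thesis by (simp add: algebra_simps)
  qed
  moreover have "D * ((1 - t) * snd a + t * snd c) = D * ((1 - r) * snd b + r * snd d)"
  proof -
    have "D * ((1 - t) * snd a + t * snd c) = D * snd a + (D * t) * (snd c - snd a)"
      by (simp add: algebra_simps)
    also have "\<dots> = D * snd b + (D * r) * (snd d - snd b)"
      unfolding t r unfolding D_def det3_def by (simp add: algebra_simps)
    finally show ?thesis by (simp add: algebra_simps)
  qed
  ultimately have "(1 - t) *\<^sub>R a + t *\<^sub>R c = (1 - r) *\<^sub>R b + r *\<^sub>R d"
    using D by (simp add: prod_eq_iff)
  moreover have "(1 - t) *\<^sub>R a + t *\<^sub>R c \<in> closed_segment a c"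
    using tr by (auto simp: closed_segment_def)
  moreover have "(1 - r) *\<^sub>R b + r *\<^sub>R d \<in> closed_segment b d"
    using tr by (auto simp: closed_segment_def)
  ultimately show ?thesis by auto
qed

lemma ccw_crossing:
  assumes "ccw_order N p" "i < k" "k < j" "j < l" "l < N"
  shows "closed_segment (p i) (p j) \<inter> closed_segment (p k) (p l) \<noteq> {}"
  by (rule diagonals_meet) (use assms in \<open>auto simp: ccw_order_def\<close>)

text \<open>The line through \<open>p i\<close> and \<open>p j\<close> has the indices strictly
  between \<open>i\<close> and \<open>j\<close> on one side and those outside on the other. Without
  interleaving, \<open>p k\<close> and \<open>p l\<close> lie weakly on the same side, and
  \<open>segment_side_inter\<close> or its mirror image applies.\<close>

lemma ccw_noncrossing:
  assumes o: "ccw_order N p" and "i < j" "j < N" "k < l" "l < N" "{i, j} \<noteq> {k, l}"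
    and n: "\<not> (i < k \<and> k < j \<and> j < l)" "\<not> (k < i \<and> i < l \<and> l < j)"
  shows "closed_segment (p i) (p j) \<inter> closed_segment (p k) (p l) \<subseteq> p ` ({i, j} \<inter> {k, l})"
proof
  fix x assume x: "x \<in> closed_segment (p i) (p j) \<inter> closed_segment (p k) (p l)"
  have gt: "det3 (p i) (p j) (p m) > 0" if "m < N" "m < i \<or> j < m" for m
    using that(2)
  proof
    assume "m < i"
    hence "det3 (p m) (p i) (p j) > 0" using o assms by (simp add: ccw_order_def)
    thus ?thesis by (simp only: det3_rotate[of "p m"])
  qed (use o that in \<open>simp add: ccw_order_def assms\<close>)
  have lt: "det3 (p i) (p j) (p m) < 0" if "i < m" "m < j" for m
    using o that assms det3_swap[of "p i" "p j" "p m"] by (auto simp: ccw_order_def)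
  have z: "det3 (p i) (p j) (p i) = 0" "det3 (p i) (p j) (p j) = 0" by simp_all
  have le: "m \<in> {i, j} \<or> m < i \<or> j < m \<or> (i < m \<and> m < j)" for m by auto
  have iff0: "det3 (p i) (p j) (p m) = 0 \<longleftrightarrow> m \<in> {i, j}" if "m < N" for m
    using gt[of m] lt[of m] le[of m] z that by force
  have "\<not> (k \<in> {i, j} \<and> l \<in> {i, j})" using assms(2,4,6) by auto
  hence not_both: "det3 (p i) (p j) (p k) \<noteq> 0 \<or> det3 (p i) (p j) (p l) \<noteq> 0"
    using iff0[of k] iff0[of l] assms(4,5) by auto
  have "(x = p k \<and> det3 (p i) (p j) (p k) = 0) \<or> (x = p l \<and> det3 (p i) (p j) (p l) = 0)"
  proof (cases "(k \<le> i \<or> j \<le> k) \<and> (l \<le> i \<or> j \<le> l)")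
    case True
    have "det3 (p i) (p j) (p m) \<ge> 0" if "m \<in> {k, l}" for m
    proof -
      have "m \<in> {i, j} \<or> m < i \<or> j < m" "m < N" using that True assms(2-5) by auto
      thus ?thesis using gt[of m] z by fastforce
    qed
    hence "det3 (p i) (p j) (p k) \<ge> 0" "det3 (p i) (p j) (p l) \<ge> 0" by simp_all
    moreover from this have "det3 (p i) (p j) (p k) + det3 (p i) (p j) (p l) > 0"
      using not_both by linarith
    ultimately show ?thesis using x by (intro segment_side_inter) auto
  next
    case False
    hence kl: "k \<in> {i..j}" "l \<in> {i..j}" using n assms(2-5) by auto
    have "det3 (p i) (p j) (p m) \<le> 0" if "m \<in> {k, l}" for m
    proof -
      have "m \<in> {i, j} \<or> (i < m \<and> m < j)" using that kl by auto
      thus ?thesis using lt[of m] z by fastforce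
    qed
    hence "det3 (p i) (p j) (p k) \<le> 0" "det3 (p i) (p j) (p l) \<le> 0" by simp_all
    moreover from this have "det3 (p i) (p j) (p k) + det3 (p i) (p j) (p l) < 0"
      using not_both by linarith
    ultimately show ?thesis using x by (intro segment_side_inter') auto
  qed
  thus "x \<in> p ` ({i, j} \<inter> {k, l})"
    using iff0[of k] iff0[of l] assms by auto
qed

text \<open>A line separates \<open>p0\<close> from the other points, so these are seen from
  \<open>p0\<close> within an open half-plane and can be sorted by angle. Convex position excludes
  equal angles and orients the triples that avoid \<open>p0\<close>.\<close>

lemma convex_position_imp_ccw_order:
  assumes P: "convex_position P" and p0: "p0 \<in> P"
  shows "\<exists>p. ccw_order (card P) p \<and> bij_betw p {..<card P} P"
proof -
  define Q where "Q = P - {p0}"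
  have fin: "finite P" "finite Q" using P by (auto simp: convex_position_def Q_def)
  have hull: "q \<notin> convex hull (P - {q})" if "q \<in> P" for q
    using P that by (auto simp: convex_position_def)
  have hull': "q \<notin> convex hull T" if "q \<in> P" "T \<subseteq> P - {q}" for q T
    using hull[OF that(1)] hull_mono[OF that(2)] by blast
  have "closed (convex hull Q)"
    using fin by (simp add: finite_imp_compact_convex_hull compact_imp_closed)
  then obtain a b where ab: "a \<bullet> p0 < b" "\<And>x. x \<in> convex hull Q \<Longrightarrow> a \<bullet> x > b"
    using separating_hyperplane_closed_point[of "convex hull Q" p0] hull[OF p0] 
    unfolding Q_def by auto
  \<comment> \<open>Coordinates of \<open>x - p0\<close> along and across the normal \<open>a\<close>; sorting by \<open>w x / u x\<close> is sorting by angle.\<close>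
  define u where "u x = fst a * (fst x - fst p0) + snd a * (snd x - snd p0)" for x
  define w where "w x = fst a * (snd x - snd p0) - snd a * (fst x - fst p0)" for x
  have u: "u x > 0" if "x \<in> Q" for x
    using ab(1) ab(2)[OF hull_inc[OF that]]
    by (simp add: u_def inner_prod_def algebra_simps)
  define key where "key x = w x / u x" for x
  \<comment> \<open>The normal \<open>a\<close> need not be a unit vector: passing to
    \<open>u\<close> and \<open>w\<close> is a rotation combined with a scaling, which multiplies
    determinants by \<open>A\<close>.\<close>
  define A where "A = fst a ^ 2 + snd a ^ 2"
  have Adet: "A * det3 p0 x y = u x * w y - w x * u y" for x y
    by (simp add: A_def det3_def u_def w_def algebra_simps power2_eq_square)
  have A: "A > 0" if "x \<in> Q" for x
  proof -
    have "a \<noteq> 0" using u[OF that] by (auto simp: u_def)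
    thus ?thesis by (simp add: A_def prod_eq_iff sum_power2_gt_zero_iff)
  qed
  have det_key: "det3 p0 x y > 0" if "x \<in> Q" "y \<in> Q" "key x < key y" for x y
  proof -
    have "w x * u y < u x * w y" using that u by (simp add: key_def field_simps)
    hence "A * det3 p0 x y > 0" by (simp add: Adet)
    thus ?thesis using A[OF that(1)] by (simp add: zero_less_mult_iff)
  qed
  \<comment> \<open>Equal keys put \<open>x\<close> and \<open>y\<close> on one ray from
    \<open>p0\<close>, so the nearer point would lie on the segment from \<open>p0\<close> to the
    other.\<close>
  have aux: False if "x \<in> Q" "y \<in> Q" "x \<noteq> y" "key x = key y" "u x \<le> u y" for x y
  proof -
    have e: "w x * u y = w y * u x" using that u[of x] u[of y] by (simp add: key_def field_simps)
    have "A * (u y * (fst x - fst p0)) = A * (u x * (fst y - fst p0))"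
    proof -
      have *: "A * (fst z - fst p0) = fst a * u z - snd a * w z" for z
        by (simp add: A_def u_def w_def algebra_simps power2_eq_square)
      have "A * (u y * (fst x - fst p0)) = u y * (A * (fst x - fst p0))" by simp
      also have "\<dots> = fst a * u x * u y - snd a * (w x * u y)" unfolding * by (simp add: algebra_simps)
      also have "\<dots> = u x * (A * (fst y - fst p0))" unfolding * e by (simp add: algebra_simps)
      finally show ?thesis by simp
    qed
    moreover have "A * (u y * (snd x - snd p0)) = A * (u x * (snd y - snd p0))"
    proof -
      have *: "A * (snd z - snd p0) = snd a * u z + fst a * w z" for z
        by (simp add: A_def u_def w_def algebra_simps power2_eq_square)
      have "A * (u y * (snd x - snd p0)) = u y * (A * (snd x - snd p0))" by simp
      also have "\<dots> = snd a * u x * u y + fst a * (w x * u y)" unfolding * by (simp add: algebra_simps)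
      also have "\<dots> = u x * (A * (snd y - snd p0))" unfolding * e by (simp add: algebra_simps)
      finally show ?thesis by simp
    qed
    ultimately have 1: "u y * (fst x - fst p0) = u x * (fst y - fst p0)"
      and 2: "u y * (snd x - snd p0) = u x * (snd y - snd p0)"
      using A[OF that(1)] by auto
    define t where "t = u x / u y"
    have "x = (1 - t) *\<^sub>R p0 + t *\<^sub>R y"
    proof -
      have "u y * t = u x" using u[OF that(2)] by (simp add: t_def)
      hence "u y * (fst x - fst p0) = u y * (t * (fst y - fst p0))"
        "u y * (snd x - snd p0) = u y * (t * (snd y - snd p0))"
        unfolding 1 2 by (simp_all add: mult.assoc[symmetric])
      hence "fst x - fst p0 = t * (fst y - fst p0)" "snd x - snd p0 = t * (snd y - snd p0)"
        using u[OF that(2)] by auto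
      thus ?thesis by (simp add: prod_eq_iff algebra_simps)
    qed
    moreover have "0 \<le> t" "t \<le> 1" using u[OF that(1)] u[OF that(2)] that(5) by (auto simp: t_def)
    ultimately have "x \<in> closed_segment p0 y" by (auto simp: closed_segment_def)
    hence "x \<in> convex hull {p0, y}" by (simp add: segment_convex_hull)
    moreover have "x \<notin> convex hull {p0, y}"
      using that p0 by (intro hull') (auto simp: Q_def)
    ultimately show False by simp
  qed
  have inj: "inj_on key Q"
  proof (rule inj_onI, rule ccontr)
    fix x y assume "x \<in> Q" "y \<in> Q" "key x = key y" "x \<noteq> y"
    thus False using aux[of x y] aux[of y x] by (cases "u x \<le> u y") auto
  qed
  define m where "m = card Q"
  have cP: "card P = Suc m" using card_Suc_Diff1[OF fin(1) p0] by (simp add: m_def Q_def)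
  obtain h where h: "bij_betw h {0..<card (key ` Q)} (key ` Q)" "strict_mono_on {0..<card (key ` Q)} h"
  proof
    let ?h = "\<lambda>i. sorted_list_of_set (key ` Q) ! i"
    show "bij_betw ?h {0..<card (key ` Q)} (key ` Q)"
      using fin by (intro bij_betw_nth) (auto simp: atLeast0LessThan)
    show "strict_mono_on {0..<card (key ` Q)} ?h"
      by (intro strict_mono_onI sorted_wrt_nth_less[OF sorted_list_of_set.strict_sorted_key_list_of_set]) auto
  qed
  have ck: "card (key ` Q) = m" using inj by (simp add: card_image m_def)
  define q where "q i = inv_into Q key (h i)" for i
  have bq: "bij_betw q {..<m} Q"
  proof -
    have "bij_betw (inv_into Q key \<circ> h) {0..<m} Q"
      using h(1) inj unfolding ck
      by (intro bij_betw_trans[where B = "key ` Q"]) (auto intro: bij_betw_inv_into simp: inj_on_imp_bij_betw)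
    thus ?thesis by (simp add: q_def[abs_def] comp_def atLeast0LessThan)
  qed
  have qQ: "q i \<in> Q" if "i < m" for i using bq that by (auto simp: bij_betw_def)
  have kq: "key (q i) = h i" if "i < m" for i
  proof -
    have "h i \<in> key ` Q" using h(1) that by (auto simp: bij_betw_def ck)
    thus ?thesis by (simp add: q_def f_inv_into_f)
  qed
  have q0: "det3 p0 (q i) (q j) > 0" if "i < j" "j < m" for i j
    using that h(2) by (intro det_key qQ) (auto simp: kq ck strict_mono_on_def)
  define p where "p i = (case i of 0 \<Rightarrow> p0 | Suc j \<Rightarrow> q j)" for i
  have "ccw_order (card P) p"
    unfolding ccw_order_def cP
  proof (intro allI impI)
    fix i j k assume ijk: "i < j" "j < k" "k < Suc m"
    then obtain j' k' where jk: "j = Suc j'" "k = Suc k'" "j' < k'" "k' < m"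
      by (cases j; cases k) auto
    show "det3 (p i) (p j) (p k) > 0"
    proof (cases i)
      case 0
      thus ?thesis using q0[of j' k'] jk by (simp add: p_def)
    next
      case (Suc i')
      hence i': "i' < j'" using ijk jk by simp
      \<comment> \<open>The angular order already puts \<open>q j'\<close> on the inner side of both
        triangle sides at \<open>p0\<close>; being outside the triangle, it must lie beyond the
        third side.\<close>
      have "q j' \<notin> convex hull {p0, q i', q k'}"
      proof (rule hull')
        have "q j' \<noteq> q i'" "q j' \<noteq> q k'"
          using inj_onD[OF bij_betw_imp_inj_on[OF bq], of j' i'] inj_onD[OF bij_betw_imp_inj_on[OF bq], of j' k']
            i' jk by auto
        thus "{p0, q i', q k'} \<subseteq> P - {q j'}"
          using p0 qQ[of i'] qQ[of j'] qQ[of k'] i' jk by (auto simp: Q_def)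
      qed (use qQ[of j'] jk Q_def in auto)
      moreover have "det3 p0 (q i') (q k') > 0" "det3 p0 (q i') (q j') \<ge> 0" "det3 (q k') p0 (q j') \<ge> 0"
        using q0[of i' k'] q0[of i' j'] q0[of j' k'] i' jk det3_rotate[of "q k'" p0 "q j'"] by auto
      ultimately have "\<not> det3 (q i') (q k') (q j') \<ge> 0"
        using in_triangle by blast
      thus ?thesis using Suc jk det3_swap[of "q i'" "q k'" "q j'"] by (simp add: p_def)
    qed
  qed
  moreover have "bij_betw p {..<card P} P"
  proof -
    have im: "p ` {..<Suc m} = P"
    proof -
      have "p ` {..<Suc m} = insert p0 (q ` {..<m})"
        unfolding lessThan_Suc_eq_insert_0 by (simp add: p_def image_image)
      thus ?thesis using bq p0 by (auto simp: bij_betw_def Q_def)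
    qed
    hence "inj_on p {..<Suc m}" using cP by (intro eq_card_imp_inj_on) auto
    thus ?thesis using im cP by (simp add: bij_betw_def)
  qed
  ultimately show ?thesis by blast
qed

text \<open>The cases record how many of the three indices wrap around; \<open>det3\<close> is
  invariant under cyclic rotation of its arguments.\<close>

lemma ccw_order_rotate:
  assumes "ccw_order n p" "m \<le> n"
  shows "ccw_order n (\<lambda>j. if j < n - m then p (j + m) else p (j - (n - m)))"
  unfolding ccw_order_def
proof (intro allI impI)
  fix i j k assume ijk: "i < j" "j < k" "k < n"
  let ?p = "\<lambda>j. if j < n - m then p (j + m) else p (j - (n - m))"
  have D: "det3 (p i) (p j) (p k) > 0" if "i < j" "j < k" "k < n" for i j k
    using assms that by (auto simp: ccw_order_def)
  consider "k < n - m" | "j < n - m" "n - m \<le> k" | "i < n - m" "n - m \<le> j" | "n - m \<le> i"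
    by linarith
  thus "det3 (?p i) (?p j) (?p k) > 0"
  proof cases
    case 1
    thus ?thesis using ijk D[of "i + m" "j + m" "k + m"] by auto
  next
    case 2
    thus ?thesis using ijk assms(2) D[of "k - (n - m)" "i + m" "j + m"] det3_rotate[of "p (k - (n - m))"] by auto
  next
    case 3
    thus ?thesis using ijk assms(2) D[of "j - (n - m)" "k - (n - m)" "i + m"]
       det3_rotate[of "p (i + m)"] by auto
  next
    case 4
    thus ?thesis using ijk assms(2) D[of "i - (n - m)" "j - (n - m)" "k - (n - m)"] by auto
  qed
qed

lemma rotate_bij:
  fixes p :: "nat \<Rightarrow> 'a" and m n :: nat
  assumes "bij_betw p {..<n} P" "m \<le> n"
  shows "bij_betw (\<lambda>j. if j < n - m then p (j + m) else p (j - (n - m))) {..<n} P"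
    (is "bij_betw ?p _ _")
proof -
  have "?p ` {..<n} = p ` {..<n}"
  proof (intro equalityI subsetI)
    fix x assume "x \<in> p ` {..<n}"
    then obtain i where i: "i < n" "x = p i" by auto
    show "x \<in> ?p ` {..<n}"
    proof (cases "i < m")
      case True
      thus ?thesis using i assms(2) by (intro image_eqI[of _ _ "i + (n - m)"]) auto
    next
      case False
      thus ?thesis using i assms(2) by (intro image_eqI[of _ _ "i - m"]) auto
    qed
  qed (use assms(2) in \<open>auto split: if_splits\<close>)
  hence im: "?p ` {..<n} = P" using assms(1) by (simp add: bij_betw_def)
  moreover have "card P = n" using assms(1) bij_betw_same_card by fastforce
  ultimately show ?thesis by (auto simp: bij_betw_def intro!: eq_card_imp_inj_on)
qed

section \<open>Crossings in terms of indices\<close>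

definition index_noncrossing :: "('v \<Rightarrow> nat) \<Rightarrow> 'v set set \<Rightarrow> bool" where
  "index_noncrossing h E \<longleftrightarrow> (\<forall>x y u w. {x, y} \<in> E \<longrightarrow> {u, w} \<in> E \<longrightarrow>
     \<not> (h x < h u \<and> h u < h y \<and> h y < h w))"

text \<open>Used in both directions: to read off the structure of a given drawing and to certify the
  constructed copy. One interleaving pattern suffices in \<open>index_noncrossing\<close> because
  its variables range over all namings of the two edges.\<close>

lemma noncrossing_embedding_iff:
  assumes o: "ccw_order N p" "inj_on p {..<N}" and G: "simple_graph V E"
    and h: "inj_on h V" "h ` V \<subseteq> {..<N}" and \<phi>: "\<And>v. v \<in> V \<Longrightarrow> \<phi> v = p (h v)"
  shows "noncrossing_embedding \<phi> V E \<longleftrightarrow> index_noncrossing h E"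
proof
  have edge: "x \<in> V \<and> y \<in> V \<and> x \<noteq> y" if "{x, y} \<in> E" for x y
    using G that unfolding simple_graph_def by (metis doubleton_eq_iff)
  show "index_noncrossing h E" if n: "noncrossing_embedding \<phi> V E"
    unfolding index_noncrossing_def
  proof (intro allI impI notI)
    fix x y u w assume e: "{x, y} \<in> E" "{u, w} \<in> E" and lt: "h x < h u \<and> h u < h y \<and> h y < h w"
    have V: "x \<in> V" "y \<in> V" "u \<in> V" "w \<in> V" using e edge by auto
    have d: "{x, y} \<inter> {u, w} = {}" using lt by auto
    hence "closed_segment (\<phi> x) (\<phi> y) \<inter> closed_segment (\<phi> u) (\<phi> w) \<subseteq> {}"
      using n e unfolding noncrossing_embedding_def by (metis image_empty inf.idem insert_not_empty)
    moreover have "h w < N" using h V by auto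
    ultimately show False
      using ccw_crossing[OF o(1), of "h x" "h u" "h y" "h w"] lt V by (simp add: \<phi>)
  qed
  show "noncrossing_embedding \<phi> V E" if n: "index_noncrossing h E"
    unfolding noncrossing_embedding_def
  proof (intro conjI allI impI)
    have "inj_on (p \<circ> h) V"
      using h o(2) by (meson comp_inj_on inj_on_subset)
    thus "inj_on \<phi> V" using \<phi> by (simp cong: inj_on_cong)
    have ordered: "closed_segment (\<phi> x) (\<phi> y) \<inter> closed_segment (\<phi> u) (\<phi> w) \<subseteq> \<phi> ` ({x, y} \<inter> {u, w})"
      if e: "{x, y} \<in> E" "{u, w} \<in> E" "{x, y} \<noteq> {u, w}" and lt: "h x < h y" "h u < h w" for x y u w
    proof -
      have V: "x \<in> V" "y \<in> V" "u \<in> V" "w \<in> V" using e edge by auto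
      have N: "h y < N" "h w < N" using h V by auto
      have "h ` {x, y} \<noteq> h ` {u, w}"
        using e(3) V h(1) by (subst inj_on_image_eq_iff[of h V]) auto
      hence ne: "{h x, h y} \<noteq> {h u, h w}" by simp
      have "closed_segment (\<phi> x) (\<phi> y) \<inter> closed_segment (\<phi> u) (\<phi> w) \<subseteq> p ` ({h x, h y} \<inter> {h u, h w})"
        using ccw_noncrossing[OF o(1) lt(1) N(1) lt(2) N(2) ne] n e V
        unfolding index_noncrossing_def by (simp add: \<phi>)
      also have "{h x, h y} \<inter> {h u, h w} = h ` ({x, y} \<inter> {u, w})"
        using V h(1) by (subst inj_on_image_Int[of h V]) auto
      also have "p ` h ` ({x, y} \<inter> {u, w}) = \<phi> ` ({x, y} \<inter> {u, w})"
        unfolding image_image using V by (intro image_cong) (auto simp: \<phi>)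
      finally show ?thesis .
    qed
    fix x y u w assume e: "{x, y} \<in> E" "{u, w} \<in> E" "{x, y} \<noteq> {u, w}"
    have "h x \<noteq> h y" "h u \<noteq> h w" using edge[OF e(1)] edge[OF e(2)] h(1) by (auto dest: inj_onD)
    then consider "h x < h y" "h u < h w" | "h x < h y" "h w < h u" | "h y < h x" "h u < h w" |
      "h y < h x" "h w < h u" by linarith
    thus "closed_segment (\<phi> x) (\<phi> y) \<inter> closed_segment (\<phi> u) (\<phi> w) \<subseteq> \<phi> ` ({x, y} \<inter> {u, w})"
      using ordered[of x y u w] ordered[of x y w u] ordered[of y x u w] ordered[of y x w u] e
      by cases (simp_all add: insert_commute closed_segment_commute)
  qed
qed

text \<open>The new order starts right after a change from \<open>T\<close> to \<open>S\<close>. If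
  the given order has no such change, then \<open>S\<close> already precedes
  \<open>T\<close>.\<close>

lemma ccw_order_split:
  assumes o: "ccw_order n p" "bij_betw p {..<n} P"
    and P: "P = S \<union> T" "S \<inter> T = {}" "S \<noteq> {}" "T \<noteq> {}"
  shows "\<exists>p'. ccw_order n p' \<and> bij_betw p' {..<n} P \<and> p' 0 \<in> S \<and> p' (n - 1) \<in> T"
proof -
  have im: "p ` {..<n} = P" using o(2) by (simp add: bij_betw_def)
  have "n \<noteq> 0"
  proof
    assume "n = 0" thus False using im P by auto
  qed
  show ?thesis
  proof (cases "\<exists>i. Suc i < n \<and> p i \<in> T \<and> p (Suc i) \<in> S")
    case True
    then obtain i where i: "Suc i < n" "p i \<in> T" "p (Suc i) \<in> S" by auto
    let ?p = "\<lambda>j. if j < n - Suc i then p (j + Suc i) else p (j - (n - Suc i))"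
    have "ccw_order n ?p" "bij_betw ?p {..<n} P"
      using ccw_order_rotate[OF o(1), of "Suc i"] rotate_bij[OF o(2), of "Suc i"] i by auto
    moreover have "?p 0 \<in> S" "?p (n - 1) \<in> T"
      using i by (auto simp: not_less)
    ultimately show ?thesis by blast
  next
    case False
    have up: "p j \<in> T" if "i \<le> j" "j < n" "p i \<in> T" for i j
      using that
    proof (induction j rule: dec_induct)
      case (step j)
      hence "p (Suc j) \<in> P" using im by auto
      thus ?case using step False P by auto
    qed
    have "p 0 \<in> S"
    proof (rule ccontr)
      assume "p 0 \<notin> S"
      hence "p 0 \<in> T" using im P \<open>n \<noteq> 0\<close> by auto
      hence "P \<subseteq> T" using up[of 0] im by auto
      thus False using P by auto
    qed
    moreover have "p (n - 1) \<in> T"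
    proof -
      obtain t where "t \<in> T" using P(4) by auto
      then obtain i where "i < n" "p i \<in> T" using P(1) im by (metis UnI2 imageE lessThan_iff)
      thus ?thesis using up[of i "n - 1"] by auto
    qed
    ultimately show ?thesis using o by blast
  qed
qed

section \<open>Staircases and strips\<close>

definition staircase :: "nat \<Rightarrow> (nat \<Rightarrow> nat \<times> nat) \<Rightarrow> bool" where
  "staircase L s \<longleftrightarrow> s 0 = (0, 0) \<and>
     (\<forall>k<L. s (Suc k) = (Suc (fst (s k)), snd (s k)) \<or> s (Suc k) = (fst (s k), Suc (snd (s k))))"

lemma staircase_mono:
  assumes "staircase L s" "m \<le> k" "k \<le> L"
  shows "fst (s m) \<le> fst (s k) \<and> snd (s m) \<le> snd (s k)"
  using assms(2,3)
proof (induction k rule: dec_induct)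
  case (step k)
  hence "s (Suc k) = (Suc (fst (s k)), snd (s k)) \<or> s (Suc k) = (fst (s k), Suc (snd (s k)))"
    using assms(1) by (auto simp: staircase_def)
  thus ?case using step by auto
qed auto

text \<open>Induction by removing the corner \<open>(a, b)\<close>. The chain condition forbids the
  remaining cells to meet both the last column and the last row, so the box shrinks by one of them,
  and the smaller staircase reaches the corner in one more step.\<close>

lemma chain_subset_staircase:
  assumes "C \<subseteq> {..a} \<times> {..b}"
    and "\<And>i j k l. (i, j) \<in> C \<Longrightarrow> (k, l) \<in> C \<Longrightarrow> i < k \<Longrightarrow> j \<le> l"
  shows "\<exists>s. staircase (a + b) s \<and> s (a + b) = (a, b) \<and> C \<subseteq> s ` {..a + b}"
  using assms
proof (induction "a + b" arbitrary: a b C)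
  case 0
  thus ?case by (intro exI[of _ "\<lambda>_. (0, 0)"]) (auto simp: staircase_def)
next
  case (Suc L)
  define C' where "C' = C - {(a, b)}"
  have "(0 < a \<and> C' \<subseteq> {..a - 1} \<times> {..b}) \<or> (0 < b \<and> C' \<subseteq> {..a} \<times> {..b - 1})"
  proof (rule ccontr)
    assume neg: "\<not> ?thesis"
    have 1: "\<exists>j<b. (a, j) \<in> C" if pos: "a > 0"
    proof -
      obtain i j where ij: "(i, j) \<in> C'" "(i, j) \<notin> {..a - 1} \<times> {..b}"
        using neg pos by (metis subrelI)
      hence "i \<le> a" "j \<le> b" "(i, j) \<in> C" "(i, j) \<noteq> (a, b)" using Suc.prems(1) by (auto simp: C'_def)
      with ij have "i = a" "j < b" by auto
      with \<open>(i, j) \<in> C\<close> show ?thesis by auto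
    qed
    have 2: "\<exists>i<a. (i, b) \<in> C" if pos: "b > 0"
    proof -
      obtain i j where ij: "(i, j) \<in> C'" "(i, j) \<notin> {..a} \<times> {..b - 1}"
        using neg pos by (metis subrelI)
      hence "i \<le> a" "j \<le> b" "(i, j) \<in> C" "(i, j) \<noteq> (a, b)" using Suc.prems(1) by (auto simp: C'_def)
      with ij have "j = b" "i < a" by auto
      with \<open>(i, j) \<in> C\<close> show ?thesis by auto
    qed
    have "a > 0 \<or> b > 0" using Suc.hyps by auto
    hence "a > 0" "b > 0" using 1 2 by auto
    then obtain i j where "j < b" "(a, j) \<in> C" "i < a" "(i, b) \<in> C" using 1 2 by auto
    thus False using Suc.prems(2)[of i b a j] by auto
  qed
  then obtain a' b' where ab: "a' + b' = L" "C' \<subseteq> {..a'} \<times> {..b'}"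
      "(a, b) = (Suc a', b') \<or> (a, b) = (a', Suc b')"
  proof
    assume "0 < a \<and> C' \<subseteq> {..a - 1} \<times> {..b}"
    thus ?thesis using that[of "a - 1" b] Suc.hyps(2) by auto
  next
    assume "0 < b \<and> C' \<subseteq> {..a} \<times> {..b - 1}"
    thus ?thesis using that[of a "b - 1"] Suc.hyps(2) by auto
  qed
  have "j \<le> l" if "(i, j) \<in> C'" "(k, l) \<in> C'" "i < k" for i j k l
    using that Suc.prems(2)[of i j k l] by (auto simp: C'_def)
  then obtain s where s: "staircase L s" "s L = (a', b')" "C' \<subseteq> s ` {..L}"
    using Suc.hyps(1)[of a' b' C'] ab by auto
  define s' where "s' = s(Suc L := (a, b))"
  have "staircase (Suc L) s'"
    using s ab(3) unfolding staircase_def s'_def by (auto simp: less_Suc_eq)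
  moreover have "C \<subseteq> s' ` {..Suc L}"
  proof
    fix x assume x: "x \<in> C"
    show "x \<in> s' ` {..Suc L}"
    proof (cases "x = (a, b)")
      case True
      thus ?thesis by (intro image_eqI[of _ _ "Suc L"]) (auto simp: s'_def)
    next
      case False
      then obtain k where "k \<le> L" "x = s k" using x s(3) by (auto simp: C'_def)
      thus ?thesis by (intro image_eqI[of _ _ k]) (auto simp: s'_def)
    qed
  qed
  ultimately show ?case using Suc.hyps(2)[symmetric] by (intro exI[of _ s']) (auto simp: s'_def)
qed

text \<open>Walking along the path from \<open>x\<close> to \<open>y\<close>, the truth of
  \<open>Q\<close> must change across some edge. This is how the connectivity of the two paths is
  exploited.\<close>

lemma induces_path_switch:
  assumes "induces_path E S" "x \<in> S" "y \<in> S" "Q x" "\<not> Q y"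
  shows "\<exists>u\<in>S. \<exists>w\<in>S. {u, w} \<in> E \<and> Q u \<and> \<not> Q w"
proof (rule ccontr)
  assume neg: "\<not> ?thesis"
  obtain xs where xs: "set xs = S"
    "\<And>i j. i < length xs \<Longrightarrow> j < length xs \<Longrightarrow> {xs ! i, xs ! j} \<in> E \<longleftrightarrow> (i = Suc j \<or> j = Suc i)"
    using assms(1) unfolding induces_path_def by blast
  have const: "Q (xs ! i) = Q (xs ! 0)" if "i < length xs" for i
    using that
  proof (induction i)
    case (Suc i)
    have "xs ! i \<in> S" "xs ! Suc i \<in> S" using xs(1) Suc.prems by auto
    moreover have "{xs ! i, xs ! Suc i} \<in> E" "{xs ! Suc i, xs ! i} \<in> E" 
      using xs(2)[of i "Suc i"] xs(2)[of "Suc i" i] Suc.prems by auto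
    ultimately have "Q (xs ! Suc i) = Q (xs ! i)" using neg by blast
    thus ?case using Suc by simp
  qed simp
  thus False using assms xs(1) by (metis in_set_conv_nth)
qed

text \<open>Meant for an arc of the polygon whose sides are all edges. It is not known beforehand
  that \<open>h\<close> follows the order of the path; counting edges shows that no room is left for
  chords.\<close>

lemma induces_path_consecutive:
  assumes path: "induces_path E S" and h: "inj_on h S" "h ` S = {lo..hi::nat}"
    and cons: "\<And>x y. x \<in> S \<Longrightarrow> y \<in> S \<Longrightarrow> h y = Suc (h x) \<Longrightarrow> {x, y} \<in> E"
    and xy: "{x, y} \<in> E" "x \<in> S" "y \<in> S" "h x < h y"
  shows "h y = Suc (h x)"
proof -
  obtain xs where xs: "distinct xs" "set xs = S"
    "\<And>i j. i < length xs \<Longrightarrow> j < length xs \<Longrightarrow> {xs ! i, xs ! j} \<in> E \<longleftrightarrow> (i = Suc j \<or> j = Suc i)"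
    using path unfolding induces_path_def by blast
  define m where "m = length xs"
  have "m = card S" using xs(1,2) distinct_card m_def by metis
  also have "\<dots> = Suc hi - lo" using card_image[OF h(1)] h(2) by simp
  finally have m: "m - 1 = hi - lo" by simp
  define F where "F = {{x, y} |x y. x \<in> S \<and> y \<in> S \<and> {x, y} \<in> E}"
  have F: "F \<subseteq> (\<lambda>i. {xs ! i, xs ! Suc i}) ` {..<m - 1}"
  proof
    fix e assume "e \<in> F"
    then obtain x y where e: "e = {x, y}" "x \<in> S" "y \<in> S" "{x, y} \<in> E" by (auto simp: F_def)
    then obtain i j where ij: "i < m" "j < m" "x = xs ! i" "y = xs ! j"
      using xs(2) by (metis in_set_conv_nth m_def)
    hence "i = Suc j \<or> j = Suc i" using xs(3)[of i j] e by (auto simp: m_def)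
    thus "e \<in> (\<lambda>i. {xs ! i, xs ! Suc i}) ` {..<m - 1}"
      using ij e by (auto simp: insert_commute)
  qed
  define g where "g = inv_into S h"
  have g: "h (g i) = i" "g i \<in> S" if "i \<in> {lo..hi}" for i
    using that unfolding g_def h(2)[symmetric] by (auto simp: f_inv_into_f inv_into_into)
  define C where "C = (\<lambda>i. {g i, g (Suc i)}) ` {lo..<hi}"
  have "inj_on (\<lambda>i. {g i, g (Suc i)}) {lo..<hi}"
  proof (rule inj_onI)
    fix i j assume ij: "i \<in> {lo..<hi}" "j \<in> {lo..<hi}" "{g i, g (Suc i)} = {g j, g (Suc j)}"
    hence "h ` {g i, g (Suc i)} = h ` {g j, g (Suc j)}" by simp
    moreover have "h ` {g k, g (Suc k)} = {k, Suc k}" if "k \<in> {lo..<hi}" for k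
      using that g[of k] g[of "Suc k"] by simp
    ultimately have "{i, Suc i} = {j, Suc j}" using ij(1,2) by metis
    thus "i = j" by (auto simp: doubleton_eq_iff)
  qed
  hence card_C: "card C = m - 1" using m by (simp add: C_def card_image)
  have "C \<subseteq> F"
  proof
    fix e assume "e \<in> C"
    then obtain i where i: "i \<in> {lo..<hi}" "e = {g i, g (Suc i)}" by (auto simp: C_def)
    hence "{g i, g (Suc i)} \<in> E" by (intro cons) (auto simp: g)
    moreover have "g i \<in> S" "g (Suc i) \<in> S" using i by (auto simp: g)
    ultimately show "e \<in> F" using i by (auto simp: F_def)
  qed
  moreover have "finite F" using F finite_surj by blast
  moreover have "card F \<le> m - 1" using surj_card_le[OF _ F] by simp
  \<comment> \<open>The path has as many edges as \<open>h ` S\<close> has consecutive pairs, so there are no others.\<close>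
  ultimately have "C = F" using card_C by (intro card_seteq) auto
  hence "{x, y} \<in> C" using xy by (auto simp: F_def)
  then obtain i where i: "i \<in> {lo..<hi}" "{x, y} = {g i, g (Suc i)}" by (auto simp: C_def)
  thus ?thesis using xy(4) g[of i] g[of "Suc i"] by (auto simp: doubleton_eq_iff)
qed

section \<open>Triangulated strips\<close>

text \<open>Along the polygon, vertices \<open>0, \<dots>, a\<close> form one side of the strip and \<open>a + b + 1, \<dots>, a + 1\<close> the
  other, which is traversed backwards. The cells of the staircase are the edges across; the polygon
  edge from \<open>a\<close> to \<open>a + 1\<close> is its last cell \<open>(a, b)\<close>.\<close>
definition strip_edge :: "nat \<Rightarrow> nat \<Rightarrow> (nat \<Rightarrow> nat \<times> nat) \<Rightarrow> nat \<Rightarrow> nat \<Rightarrow> bool" where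
  "strip_edge a b s i j \<longleftrightarrow> j = Suc i \<or> (i \<le> a \<and> a < j \<and> (i, a + b + 1 - j) \<in> s ` {..a + b})"

definition strip_layout :: "'v set \<Rightarrow> 'v set set \<Rightarrow> ('v \<Rightarrow> nat) \<Rightarrow> nat \<Rightarrow> nat \<Rightarrow> (nat \<Rightarrow> nat \<times> nat) \<Rightarrow> bool" where
  "strip_layout V E h a b s \<longleftrightarrow> bij_betw h V {..<a + b + 2} \<and>
     staircase (a + b) s \<and> s (a + b) = (a, b) \<and>
     (\<forall>x y. {x, y} \<in> E \<longrightarrow> h x < h y \<longrightarrow> strip_edge a b s (h x) (h y))"

text \<open>Each edge has an index strictly between its ends, so neither is a polygon side and both
  come from cells. From one cell to the other the first coordinate grows while the second shrinks,
  against the monotonicity of the staircase.\<close>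

lemma strip_edges_noncrossing:
  assumes "staircase (a + b) s" "strip_edge a b s i k" "strip_edge a b s j l"
    and "i < j" "j < k" "k < l" "l < a + b + 2"
  shows False
proof -
  have "k \<noteq> Suc i" "l \<noteq> Suc j" using assms by auto
  then obtain m m' where m: "m \<le> a + b" "s m = (i, a + b + 1 - k)"
    and m': "m' \<le> a + b" "s m' = (j, a + b + 1 - l)"
    using assms(2,3) unfolding strip_edge_def by (metis imageE atMost_iff)
  show False
  proof (cases "m \<le> m'")
    case True
    thus False using staircase_mono[OF assms(1) True] m m' assms by auto
  next
    case False
    thus False using staircase_mono[OF assms(1), of m' m] m m' assms by auto
  qed
qed

section \<open>Strip layouts of graphs in \<open>PW2\<close>\<close>

lemma path_strip_layout:
  assumes G: "simple_graph V E" and path: "induces_path E V" and n: "card V = n" "n \<ge> 2"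
  shows "\<exists>h a b s. n = a + b + 2 \<and> strip_layout V E h a b s"
proof -
  obtain xs where xs: "distinct xs" "set xs = V"
    "\<And>i j. i < length xs \<Longrightarrow> j < length xs \<Longrightarrow> {xs ! i, xs ! j} \<in> E \<longleftrightarrow> (i = Suc j \<or> j = Suc i)"
    using path unfolding induces_path_def by blast
  have len: "length xs = n" using xs n distinct_card by metis
  have bij: "bij_betw ((!) xs) {..<n} V"
    using xs len by (intro bij_betw_nth) auto
  define h where "h = inv_into {..<n} ((!) xs)"
  have h: "bij_betw h V {..<n}" using bij unfolding h_def by (rule bij_betw_inv_into)
  have nth_h: "xs ! h v = v" if "v \<in> V" for v
    using that bij unfolding h_def by (simp add: bij_betw_def f_inv_into_f)
  have h_less: "h v < n" if "v \<in> V" for v using that h by (auto simp: bij_betw_def)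
  have n2: "0 + (n - 2) + 2 = n" using n by simp
  \<comment> \<open>The path is laid along the polygon. With \<open>a = 0\<close> one side is a
    single vertex, and the staircase goes straight to \<open>(0, n - 2)\<close>.\<close>
  have "strip_layout V E h 0 (n - 2) (\<lambda>k. (0, k))"
    unfolding strip_layout_def n2
  proof (intro conjI allI impI)
    fix x y assume e: "{x, y} \<in> E" "h x < h y"
    have V: "x \<in> V" "y \<in> V" using e(1) G unfolding simple_graph_def by (metis doubleton_eq_iff)+
    hence "h y = Suc (h x)"
      using xs(3)[of "h x" "h y"] e h_less[of x] h_less[of y] by (auto simp: nth_h len)
    thus "strip_edge 0 (n - 2) (\<lambda>k. (0, k)) (h x) (h y)" by (simp add: strip_edge_def)
  qed (use h n in \<open>auto simp: staircase_def\<close>)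
  thus ?thesis using n2 by metis
qed

text \<open>Maximality supplies the polygon sides, connectivity of the two paths makes their vertex
  sets arcs, an edge count excludes chords inside an arc, and absence of crossings makes the edges
  between the arcs a chain.\<close>

lemma PW2_strip_layout:
  assumes PW: "PW2 n V E" and n: "n \<ge> 2"
  shows "\<exists>h a b s. n = a + b + 2 \<and> strip_layout V E h a b s"
proof -
  have ot: "outerplanar_triangulation V E" and card: "card V = n"
    using PW by (auto simp: PW2_def)
  obtain A B where AB: "A \<union> B = V" "A \<inter> B = {}" "A = {} \<or> induces_path E A" "B = {} \<or> induces_path E B"
    using PW unfolding PW2_def by blast
  obtain \<phi> where G: "simple_graph V E" and conv: "convex_position (\<phi> ` V)"
    and nc: "noncrossing_embedding \<phi> V E"
    and max: "\<And>x y. x \<in> V \<Longrightarrow> y \<in> V \<Longrightarrow> x \<noteq> y \<Longrightarrow> {x, y} \<notin> E \<Longrightarrow> \<not> noncrossing_embedding \<phi> V (insert {x, y} E)"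
    using ot unfolding outerplanar_triangulation_def by blast
  have edge: "x \<in> V \<and> y \<in> V" if "{x, y} \<in> E" for x y
    using G that unfolding simple_graph_def by (metis doubleton_eq_iff)
  have \<phi>: "inj_on \<phi> V" using nc by (simp add: noncrossing_embedding_def)
  have cP: "card (\<phi> ` V) = n" using \<phi> card by (simp add: card_image)
  show ?thesis
  proof (cases "A = {} \<or> B = {}")
    case True
    hence "induces_path E V" using AB n card by auto
    thus ?thesis by (intro path_strip_layout G card n)
  next
    case False
    hence A: "induces_path E A" and B: "induces_path E B" and ne: "A \<noteq> {}" "B \<noteq> {}" using AB by auto
    then obtain v0 where "v0 \<in> V" using AB by auto
    then obtain p0 where "ccw_order n p0" "bij_betw p0 {..<n} (\<phi> ` V)"
      using convex_position_imp_ccw_order[OF conv, of "\<phi> v0"] unfolding cP by auto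
    moreover have "\<phi> ` A \<inter> \<phi> ` B = {}"
      using inj_on_image_Int[OF \<phi>, of A B] AB(1,2) by auto
    moreover have "\<phi> ` V = \<phi> ` A \<union> \<phi> ` B" using AB(1) by auto
    \<comment> \<open>Starting in \<open>A\<close> and ending in \<open>B\<close> lets both arcs
      become intervals of indices, with no wrap-around.\<close>
    ultimately obtain p where o: "ccw_order n p" and p: "bij_betw p {..<n} (\<phi> ` V)"
      and ends: "p 0 \<in> \<phi> ` A" "p (n - 1) \<in> \<phi> ` B"
      using ccw_order_split[of n p0 "\<phi> ` V" "\<phi> ` A" "\<phi> ` B"] ne by blast
    define h where "h v = inv_into {..<n} p (\<phi> v)" for v
    have "bij_betw (inv_into {..<n} p \<circ> \<phi>) V {..<n}"
      using \<phi> bij_betw_inv_into[OF p] by (intro bij_betw_trans[of \<phi> V "\<phi> ` V"]) (auto simp: inj_on_imp_bij_betw)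
    hence h: "bij_betw h V {..<n}" by (simp add: h_def[abs_def] comp_def)
    have ph: "\<phi> v = p (h v)" if "v \<in> V" for v
      using that p by (simp add: h_def bij_betw_def f_inv_into_f)
    have h_less: "h v < n" if "v \<in> V" for v using that h by (auto simp: bij_betw_def)
    have h_inj: "inj_on h V" "h ` V = {..<n}" using h by (auto simp: bij_betw_def)
    have h_eq: "x = y" if "h x = h y" "x \<in> V" "y \<in> V" for x y using that h_inj by (auto dest: inj_onD)
    have p_inj: "inj_on p {..<n}" using p by (simp add: bij_betw_def)
    have nc_iff: "noncrossing_embedding \<phi> V F \<longleftrightarrow> index_noncrossing h F" if "simple_graph V F" for F
      using noncrossing_embedding_iff[OF o p_inj that, of h \<phi>] h_inj ph by auto
    have no_cross: False if "{x, y} \<in> E" "{u, w} \<in> E" "h x < h u" "h u < h y" "h y < h w" for x y u w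
      using nc nc_iff[OF G] that unfolding index_noncrossing_def by blast
    \<comment> \<open>A polygon side interleaves with no edge, so by maximality it is
      present.\<close>
    have cons: "{x, y} \<in> E" if xy: "x \<in> V" "y \<in> V" "h y = Suc (h x)" for x y
    proof (rule ccontr)
      assume not: "{x, y} \<notin> E"
      have ne: "x \<noteq> y" using xy by auto
      have "simple_graph V (insert {x, y} E)" using G xy ne unfolding simple_graph_def by blast
      moreover have "index_noncrossing h (insert {x, y} E)"
        unfolding index_noncrossing_def
      proof (intro allI impI notI)
        fix x' y' u w assume e: "{x', y'} \<in> insert {x, y} E" "{u, w} \<in> insert {x, y} E"
          and lt: "h x' < h u \<and> h u < h y' \<and> h y' < h w"
        have "{x', y'} \<noteq> {x, y}" "{u, w} \<noteq> {x, y}" using lt xy(3) by (auto simp: doubleton_eq_iff)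
        thus False using e lt no_cross[of x' y' u w] by auto
      qed
      ultimately show False using max[OF xy(1,2) ne not] nc_iff by blast
    qed
    obtain a0 where a0: "a0 \<in> A" "h a0 = 0"
    proof -
      obtain v where "v \<in> A" "p 0 = \<phi> v" using ends by auto
      thus ?thesis using that[of v] ph[of v] h_less[of v] inj_onD[OF p_inj, of 0 "h v"] AB(1) n by auto
    qed
    obtain b1 where b1: "b1 \<in> B" "h b1 = n - 1"
    proof -
      obtain v where "v \<in> B" "p (n - 1) = \<phi> v" using ends by auto
      thus ?thesis using that[of v] ph[of v] h_less[of v] inj_onD[OF p_inj, of "n - 1" "h v"] AB(1) n by auto
    qed
    \<comment> \<open>If \<open>x\<close> came after \<open>y\<close>, the path on \<open>A\<close>
      from index 0 to \<open>x\<close> would jump over \<open>y\<close> by an edge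
      \<open>{u, w}\<close>. The path on \<open>B\<close> from \<open>y\<close> to the last index
      leaves the interval between \<open>u\<close> and \<open>w\<close>, and the edge by which it
      does so crosses \<open>{u, w}\<close>.\<close>
    have sep: "h x < h y" if x: "x \<in> A" and y: "y \<in> B" for x y
    proof (rule ccontr)
      assume "\<not> h x < h y"
      obtain u w where uw: "u \<in> A" "w \<in> A" "{u, w} \<in> E" "h u < h y" "\<not> h w < h y"
      proof -
        have "h y \<noteq> 0" using h_eq[of a0 y] a0 y AB by auto
        thus ?thesis
          using induces_path_switch[OF A a0(1) x, of "\<lambda>v. h v < h y"] a0 \<open>\<not> h x < h y\<close> that by auto
      qed
      have yw: "h y < h w" using h_eq[of w y] uw y AB by force
      have "h w \<le> n - 1" using h_less[of w] uw AB(1) by auto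
      then obtain u' w' where uw': "u' \<in> B" "w' \<in> B" "{u', w'} \<in> E"
        "h u < h u'" "h u' < h w" "\<not> (h u < h w' \<and> h w' < h w)"
        using induces_path_switch[OF B y b1(1), of "\<lambda>v. h u < h v \<and> h v < h w"] b1 uw yw by auto
      have "h w' \<noteq> h u" "h w' \<noteq> h w" using h_eq[of w' u] h_eq[of w' w] uw uw' AB by auto
      then consider "h w' < h u" | "h w < h w'" using uw' by linarith
      thus False
        using no_cross[of w' u' u w] no_cross[of u w u' w'] uw uw' by cases (auto simp: insert_commute)
    qed
    have finA: "finite (h ` A)" using G AB(1) unfolding simple_graph_def by (meson finite_Un finite_imageI)
    define a where "a = Max (h ` A)"
    have "a \<in> h ` A" unfolding a_def using finA ne by (intro Max_in) auto
    then obtain a1 where a1: "a1 \<in> A" "h a1 = a" by auto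
    have A_iff: "v \<in> A \<longleftrightarrow> h v \<le> a" if "v \<in> V" for v
    proof
      assume "v \<in> A" thus "h v \<le> a" unfolding a_def using finA by auto
    next
      assume "h v \<le> a"
      hence "v \<notin> B" using sep[OF a1(1), of v] a1 by auto
      thus "v \<in> A" using that AB(1) by auto
    qed
    have B_iff: "v \<in> B \<longleftrightarrow> a < h v" if "v \<in> V" for v
      using A_iff[OF that] AB that by auto
    have "a < n - 1" using sep[OF a1(1) b1(1)] a1 b1 by simp
    define b where "b = n - 2 - a"
    have nab: "n = a + b + 2" using \<open>a < n - 1\<close> by (simp add: b_def)
    have hA: "h ` A = {0..a}"
    proof -
      have "h ` A = {i \<in> h ` V. i \<le> a}" using A_iff AB(1) by auto
      thus ?thesis using h_inj nab by auto
    qed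
    have hB: "h ` B = {Suc a..n - 1}"
    proof -
      have "h ` B = {i \<in> h ` V. a < i}" using B_iff AB(1) by auto
      thus ?thesis using h_inj nab by auto
    qed
    have subs: "A \<subseteq> V" "B \<subseteq> V" using AB(1) by auto
    have inA: "h y = Suc (h x)" if "{x, y} \<in> E" "x \<in> A" "y \<in> A" "h x < h y" for x y
      using induces_path_consecutive[OF A inj_on_subset[OF h_inj(1)] hA _ that] cons subs by auto
    have inB: "h y = Suc (h x)" if "{x, y} \<in> E" "x \<in> B" "y \<in> B" "h x < h y" for x y
      using induces_path_consecutive[OF B inj_on_subset[OF h_inj(1)] hB _ that] cons subs by auto
    \<comment> \<open>Reversing the second coordinate turns the absence of crossings into weak
      monotonicity.\<close>
    define C where "C = {(h x, a + b + 1 - h y) |x y. x \<in> A \<and> y \<in> B \<and> {x, y} \<in> E}"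
    have C_sub: "C \<subseteq> {..a} \<times> {..b}"
    proof
      fix c assume "c \<in> C"
      then obtain x y where c: "c = (h x, a + b + 1 - h y)" "x \<in> A" "y \<in> B" by (auto simp: C_def)
      have "h x \<le> a" "a < h y" using c A_iff[of x] B_iff[of y] subs by auto
      thus "c \<in> {..a} \<times> {..b}" using c by auto
    qed
    have C_chain: "j \<le> l" if ij: "(i, j) \<in> C" "(k, l) \<in> C" "i < k" for i j k l
    proof (rule ccontr)
      assume "\<not> j \<le> l"
      obtain x y where xy: "x \<in> A" "y \<in> B" "{x, y} \<in> E" "i = h x" "j = a + b + 1 - h y"
        using ij(1) by (auto simp: C_def)
      obtain u w where uw: "u \<in> A" "w \<in> B" "{u, w} \<in> E" "k = h u" "l = a + b + 1 - h w"
        using ij(2) by (auto simp: C_def)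
      have "h y < h w" using xy uw \<open>\<not> j \<le> l\<close> by auto
      thus False using no_cross[OF xy(3) uw(3)] sep[OF uw(1) xy(2)] xy uw ij by auto
    qed
    have "\<exists>s. staircase (a + b) s \<and> s (a + b) = (a, b) \<and> C \<subseteq> s ` {..a + b}"
      by (rule chain_subset_staircase[OF C_sub]) (rule C_chain)
    then obtain s where s: "staircase (a + b) s" "s (a + b) = (a, b)" "C \<subseteq> s ` {..a + b}"
      by blast
    have "strip_layout V E h a b s"
      unfolding strip_layout_def
    proof (intro conjI allI impI)
      fix x y assume e: "{x, y} \<in> E" "h x < h y"
      have V: "x \<in> V" "y \<in> V" using edge e by auto
      consider "x \<in> A" "y \<in> A" | "x \<in> B" "y \<in> B" | "x \<in> A" "y \<in> B"
        using V e AB sep[of y x] by force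
      thus "strip_edge a b s (h x) (h y)"
      proof cases
        case 3
        hence "(h x, a + b + 1 - h y) \<in> s ` {..a + b}" using e s(3) by (auto simp: C_def)
        thus ?thesis using 3 A_iff B_iff V by (auto simp: strip_edge_def)
      qed (use inA inB e in \<open>auto simp: strip_edge_def\<close>)
    qed (use s h nab in auto)
    thus ?thesis using nab by blast
  qed
qed

section \<open>Monochromatic strips\<close>

text \<open>The first \<open>k\<close> steps of the staircase \<open>s\<close>, embedded in colour \<open>col\<close>: the two sides of the strip go
  to \<open>\<alpha> 0 < \<alpha> 1 < \<dots>\<close> and \<open>\<beta> 0 < \<beta> 1 < \<dots>\<close>; \<open>cA\<close> and \<open>cB\<close> colour the pairs inside the two arcs and
  \<open>cX\<close> the pairs between them.\<close>
definition strip_prefix ::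
    "(nat \<Rightarrow> nat \<Rightarrow> bool) \<Rightarrow> (nat \<Rightarrow> nat \<Rightarrow> bool) \<Rightarrow> (nat \<Rightarrow> nat \<Rightarrow> bool) \<Rightarrow> (nat \<Rightarrow> nat \<times> nat) \<Rightarrow>
      bool \<Rightarrow> nat \<Rightarrow> (nat \<Rightarrow> nat) \<Rightarrow> (nat \<Rightarrow> nat) \<Rightarrow> bool" where
  "strip_prefix cA cB cX s col k \<alpha> \<beta> \<longleftrightarrow>
     (\<forall>i<fst (s k). \<alpha> i < \<alpha> (Suc i) \<and> cA (\<alpha> i) (\<alpha> (Suc i)) = col) \<and>
     (\<forall>j<snd (s k). \<beta> j < \<beta> (Suc j) \<and> cB (\<beta> j) (\<beta> (Suc j)) = col) \<and>
     (\<forall>m\<le>k. cX (\<alpha> (fst (s m))) (\<beta> (snd (s m))) = col)"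

text \<open>By monotonicity no earlier cell has first coordinate \<open>Suc (fst (s k))\<close>, so
  redefining \<open>\<alpha>\<close> there leaves the prefix intact and only the two new edges need
  the right colour.\<close>

lemma strip_prefix_extend_left:
  assumes "staircase L s" "k < L" "s (Suc k) = (Suc (fst (s k)), snd (s k))"
    and "strip_prefix cA cB cX s col k \<alpha> \<beta>" "\<alpha> (fst (s k)) < x"
    and "cA (\<alpha> (fst (s k))) x = col" "cX x (\<beta> (snd (s k))) = col"
  shows "strip_prefix cA cB cX s col (Suc k) (\<alpha>(Suc (fst (s k)) := x)) \<beta>"
proof -
  have "fst (s m) \<noteq> Suc (fst (s k))" if "m \<le> k" for m
    using staircase_mono[OF assms(1) that] assms(2) by auto
  thus ?thesis using assms(3-) unfolding strip_prefix_def by (auto simp: less_Suc_eq le_Suc_eq)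
qed

lemma strip_prefix_extend_right:
  assumes "staircase L s" "k < L" "s (Suc k) = (fst (s k), Suc (snd (s k)))"
    and "strip_prefix cA cB cX s col k \<alpha> \<beta>" "\<beta> (snd (s k)) < y"
    and "cB (\<beta> (snd (s k))) y = col" "cX (\<alpha> (fst (s k))) y = col"
  shows "strip_prefix cA cB cX s col (Suc k) \<alpha> (\<beta>(Suc (snd (s k)) := y))"
proof -
  have "snd (s m) \<noteq> Suc (snd (s k))" if "m \<le> k" for m
    using staircase_mono[OF assms(1) that] assms(2) by auto
  thus ?thesis using assms(3-) unfolding strip_prefix_def by (auto simp: less_Suc_eq le_Suc_eq)
qed

text \<open>There are \<open>2 * L\<close> labels. Without a clique, each label occurs at most
  \<open>n - 1\<close> times at each of the \<open>M\<close> vertices of one arc, the arc depending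
  on which side grows next; without a full strip every pair is labelled, so
  \<open>M * M \<le> M * (2 * L * (n - 1))\<close>. Bounding the last vertices of the strip bounds
  all, as both sides increase.\<close>

lemma monochromatic_strip_or_clique:
  fixes cA cB cX :: "nat \<Rightarrow> nat \<Rightarrow> bool"
  assumes s: "staircase L s" and M: "2 * L * (n - 1) < M" and n: "n \<ge> 1"
  shows "(\<exists>col \<alpha> \<beta>. strip_prefix cA cB cX s col L \<alpha> \<beta> \<and> \<alpha> (fst (s L)) < M \<and> \<beta> (snd (s L)) < M) \<or>
    (\<exists>col K. K \<subseteq> {..<M} \<and> card K = n \<and> 
       ((\<forall>x\<in>K. \<forall>y\<in>K. x < y \<longrightarrow> cA x y = col) \<or> (\<forall>x\<in>K. \<forall>y\<in>K. x < y \<longrightarrow> cB x y = col)))"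
    (is "?strip \<or> ?clique")
proof (rule ccontr)
  assume neg: "\<not> (?strip \<or> ?clique)"
  have small: "card K \<le> n - 1" if "K \<subseteq> {..<M}"
    "(\<forall>x\<in>K. \<forall>y\<in>K. x < y \<longrightarrow> cA x y = col) \<or> (\<forall>x\<in>K. \<forall>y\<in>K. x < y \<longrightarrow> cB x y = col)" for K col
  proof (rule ccontr)
    assume "\<not> card K \<le> n - 1"
    hence "n \<le> card K" by simp
    then obtain T where T: "T \<subseteq> K" "card T = n" by (meson obtain_subset_with_card_n)
    hence "?clique" using that by (intro exI[of _ col] exI[of _ T]) blast
    thus False using neg by blast
  qed
  define reach where "reach a b k \<longleftrightarrow> (\<exists>\<alpha> \<beta>. strip_prefix cA cB cX s (cX a b) k \<alpha> \<beta> \<and> 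
    \<alpha> (fst (s k)) = a \<and> \<beta> (snd (s k)) = b)" for a b k
  define r where "r a b = Max {k. k \<le> L \<and> reach a b k}" for a b
  \<comment> \<open>A single edge is a prefix of length 0, so the maximum in \<open>r\<close> is
    over a nonempty set.\<close>
  have "reach a b 0" for a b
    using s unfolding reach_def strip_prefix_def staircase_def
    by (intro exI[of _ "\<lambda>_. a"] exI[of _ "\<lambda>_. b"]) auto
  hence "r a b \<in> {k. k \<le> L \<and> reach a b k}" for a b
    unfolding r_def by (intro Max_in) auto
  hence r: "r a b \<le> L" "reach a b (r a b)" for a b by auto
  have r_max: "k \<le> r a b" if "k \<le> L" "reach a b k" for a b k
    using that by (auto simp: r_def)
  have r_less: "r a b < L" if "a < M" "b < M" for a b
  proof -
    have "\<not> reach a b L" using neg that unfolding reach_def by blast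
    thus ?thesis using r[of a b] by (cases "r a b = L") auto
  qed
  \<comment> \<open>Otherwise appending \<open>a'\<close> to a prefix that ends in
    \<open>(a, b)\<close> gives one of length \<open>Suc k\<close> that ends in
    \<open>(a', b)\<close>, contrary to \<open>r a' b = k\<close>.\<close>
  have left: "cA a a' = (\<not> col)"
    if "a < a'" "cX a b = col" "cX a' b = col" "r a b = k" "r a' b = k" "k < L"
      "s (Suc k) = (Suc (fst (s k)), snd (s k))" for a a' b col k
  proof (rule ccontr)
    assume c: "cA a a' \<noteq> (\<not> col)"
    obtain \<alpha> \<beta> where ab: "strip_prefix cA cB cX s col k \<alpha> \<beta>" "\<alpha> (fst (s k)) = a" "\<beta> (snd (s k)) = b"
      using r(2)[of a b] unfolding reach_def \<open>r a b = k\<close> \<open>cX a b = col\<close> by blast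
    have "strip_prefix cA cB cX s col (Suc k) (\<alpha>(Suc (fst (s k)) := a')) \<beta>"
      using that ab c by (intro strip_prefix_extend_left[OF s]) auto
    hence "reach a' b (Suc k)" using that ab unfolding reach_def
      by (intro exI[of _ "\<alpha>(Suc (fst (s k)) := a')"] exI[of _ \<beta>]) auto
    thus False using r_max[of "Suc k" a' b] that by auto
  qed
  have right: "cB b b' = (\<not> col)"
    if "b < b'" "cX a b = col" "cX a b' = col" "r a b = k" "r a b' = k" "k < L"
      "s (Suc k) = (fst (s k), Suc (snd (s k)))" for a b b' col k
  proof (rule ccontr)
    assume c: "cB b b' \<noteq> (\<not> col)"
    obtain \<alpha> \<beta> where ab: "strip_prefix cA cB cX s col k \<alpha> \<beta>" "\<alpha> (fst (s k)) = a" "\<beta> (snd (s k)) = b"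
      using r(2)[of a b] unfolding reach_def \<open>r a b = k\<close> \<open>cX a b = col\<close> by blast
    have "strip_prefix cA cB cX s col (Suc k) \<alpha> (\<beta>(Suc (snd (s k)) := b'))"
      using that ab c by (intro strip_prefix_extend_right[OF s]) auto
    hence "reach a b' (Suc k)" using that ab unfolding reach_def
      by (intro exI[of _ \<alpha>] exI[of _ "\<beta>(Suc (snd (s k)) := b')"]) auto
    thus False using r_max[of "Suc k" a b'] that by auto
  qed
  define S where "S l = {(a, b). a < M \<and> b < M \<and> (cX a b, r a b) = l}" for l
  have fin: "finite (S l)" for l
    by (rule finite_subset[of _ "{..<M} \<times> {..<M}"]) (auto simp: S_def)
  have card_S: "card (S l) \<le> M * (n - 1)" if l_in: "l \<in> UNIV \<times> {..<L}" for l
  proof -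
    obtain col k where l: "l = (col, k)" "k < L" using l_in by auto
    have "s (Suc k) = (Suc (fst (s k)), snd (s k)) \<or> s (Suc k) = (fst (s k), Suc (snd (s k)))"
      using s l by (auto simp: staircase_def)
    thus ?thesis
    proof
      assume st: "s (Suc k) = (Suc (fst (s k)), snd (s k))"
      \<comment> \<open>The left side grows next, so equal labels are compared at a common right end
        \<open>b\<close>, and the label class is counted fibre by fibre over
        \<open>b\<close>.\<close>
      let ?K = "\<lambda>b. {a. a < M \<and> cX a b = col \<and> r a b = k}"
      have "S l = prod.swap ` (SIGMA b:{..<M}. ?K b)" by (auto simp: S_def l image_iff)
      hence "card (S l) \<le> card (SIGMA b:{..<M}. ?K b)"
        by (simp only:) (intro card_image_le finite_SigmaI; simp)
      also have "\<dots> = (\<Sum>b<M. card (?K b))" by simp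
      also have "\<dots> \<le> (\<Sum>b<M. n - 1)"
      proof (intro sum_mono small[of _ "\<not> col"] disjI1 ballI impI)
        show "cA x y = (\<not> col)" if "x \<in> ?K b" "y \<in> ?K b" "x < y" for b x y
          using that by (intro left[of _ _ b col k] st l(2)) auto
      qed auto
      finally show ?thesis by simp
    next
      assume st: "s (Suc k) = (fst (s k), Suc (snd (s k)))"
      let ?K = "\<lambda>a. {b. b < M \<and> cX a b = col \<and> r a b = k}"
      have "S l = (SIGMA a:{..<M}. ?K a)" by (auto simp: S_def l)
      hence "card (S l) = (\<Sum>a<M. card (?K a))" by simp
      also have "\<dots> \<le> (\<Sum>a<M. n - 1)"
      proof (intro sum_mono small[of _ "\<not> col"] disjI2 ballI impI)
        show "cB x y = (\<not> col)" if "x \<in> ?K a" "y \<in> ?K a" "x < y" for a x y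
          using that by (intro right[of _ _ a col k] st l(2)) auto
      qed auto
      finally show ?thesis by simp
    qed
  qed
  have "{..<M} \<times> {..<M} \<subseteq> (\<Union>l\<in>UNIV \<times> {..<L}. S l)"
    using r_less by (auto simp: S_def)
  hence "card ({..<M} \<times> {..<M}) \<le> card (\<Union>l\<in>(UNIV::bool set) \<times> {..<L}. S l)"
    using fin by (intro card_mono) auto
  also have "\<dots> \<le> (\<Sum>l\<in>(UNIV::bool set) \<times> {..<L}. card (S l))"
    by (intro card_UN_le) auto
  also have "\<dots> \<le> (\<Sum>l\<in>(UNIV::bool set) \<times> {..<L}. M * (n - 1))"
    by (intro sum_mono card_S)
  also have "\<dots> = M * (2 * L * (n - 1))" by simp
  finally have "M * M \<le> M * (2 * L * (n - 1))" by simp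
  thus False using M by simp
qed

section \<open>Transfer to one linear order of indices\<close>

lemma strictly_increasing_lift:
  fixes f :: "nat \<Rightarrow> nat"
  assumes "\<And>i. Suc i < n \<Longrightarrow> f i < f (Suc i)" "i < j" "j < n"
  shows "f i < f j"
  using assms(2,3)
proof (induction j)
  case (Suc j)
  thus ?case using assms(1)[of j] by (cases "i = j") auto
qed simp

text \<open>The two halves of the index range serve as the arcs. A clique inside an arc suffices on
  its own: enumerated increasingly, all its pairs have the colour, whichever of them are strip
  edges.\<close>

lemma monochromatic_strip:
  fixes c :: "nat \<Rightarrow> nat \<Rightarrow> bool"
  assumes s: "staircase (a + b) s" "s (a + b) = (a, b)" and n: "n = a + b + 2"
    and M: "2 * (a + b) * (n - 1) < M"
  shows "\<exists>f col. (\<forall>i j. i < j \<longrightarrow> j < n \<longrightarrow> f i < f j) \<and> (\<forall>i<n. f i < 2 * M) \<and>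
    (\<forall>i j. i < j \<longrightarrow> j < n \<longrightarrow> strip_edge a b s i j \<longrightarrow> c (f i) (f j) = col)"
proof -
  \<comment> \<open>\<open>R\<close> reads the second half backwards, matching the reversed side of
    the strip. As it reverses the order, its arguments appear swapped in the colouring of that
    arc.\<close>
  define R where "R x = 2 * M - 1 - x" for x
  have clique: ?thesis if K: "K \<subseteq> {..<2 * M}" "card K = n" "\<And>x y. x \<in> K \<Longrightarrow> y \<in> K \<Longrightarrow> x < y \<Longrightarrow> c x y = col" for K col
  proof -
    have fin: "finite K" using K(1) finite_subset by blast
    obtain f where f: "bij_betw f {..<card K} K" "strict_mono_on {..<card K} f"
      by (rule ex_bij_betw_strict_mono_card[OF fin])
    have fK: "f i \<in> K" if "i < n" for i using f(1) that K(2) by (auto simp: bij_betw_def)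
    have lt: "f i < f j" if "i < j" "j < n" for i j
      using f(2) that K(2) by (auto simp: strict_mono_on_def)
    show ?thesis
    proof (intro exI[of _ f] exI[of _ col] conjI allI impI)
      show "f i < 2 * M" if "i < n" for i using fK[OF that] K(1) by auto
      show "c (f i) (f j) = col" if "i < j" "j < n" for i j
        using that by (intro K(3) fK lt) auto
    qed (rule lt)
  qed
  consider (strip) col \<alpha> \<beta> where
      "strip_prefix c (\<lambda>x y. c (R y) (R x)) (\<lambda>x y. c x (R y)) s col (a + b) \<alpha> \<beta>" "\<alpha> a < M" "\<beta> b < M"
    | (A) col K where "K \<subseteq> {..<M}" "card K = n" "\<forall>x\<in>K. \<forall>y\<in>K. x < y \<longrightarrow> c x y = col"
    | (B) col K where "K \<subseteq> {..<M}" "card K = n" "\<forall>x\<in>K. \<forall>y\<in>K. x < y \<longrightarrow> c (R y) (R x) = col"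
    using monochromatic_strip_or_clique[OF s(1) M, of c "\<lambda>x y. c (R y) (R x)" "\<lambda>x y. c x (R y)"] n s(2)
    by force
  thus ?thesis
  proof cases
    case A
    thus ?thesis by (intro clique[of K col]) auto
  next
    case B
    have "inj_on R K" using B(1) by (auto simp: inj_on_def R_def)
    hence "card (R ` K) = n" using B(2) by (simp add: card_image)
    moreover have "R x < R y \<longleftrightarrow> y < x" if "x \<in> K" "y \<in> K" for x y
      using that B(1) by (auto simp: R_def subset_iff)
    ultimately show ?thesis
    proof (intro clique[of "R ` K" col])
      show "R ` K \<subseteq> {..<2 * M}" using M by (auto simp: R_def)
    qed (use B(3) in auto)
  next
    case strip
    \<comment> \<open>Index \<open>a + 1\<close> is sent to the last right vertex
      \<open>\<beta> b\<close> and index \<open>a + b + 1\<close> to \<open>\<beta> 0\<close>;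
      composed with \<open>R\<close>, this keeps \<open>f\<close> increasing.\<close>
    define f where "f i = (if i \<le> a then \<alpha> i else R (\<beta> (a + b + 1 - i)))" for i
    have \<alpha>: "\<alpha> i < \<alpha> (Suc i)" "c (\<alpha> i) (\<alpha> (Suc i)) = col" if "i < a" for i
      using strip(1) that s(2) by (auto simp: strip_prefix_def)
    have \<beta>: "\<beta> j < \<beta> (Suc j)" "c (R (\<beta> (Suc j))) (R (\<beta> j)) = col" if "j < b" for j
      using strip(1) that s(2) by (auto simp: strip_prefix_def)
    have cell: "c (\<alpha> i) (R (\<beta> j)) = col" if ij: "(i, j) \<in> s ` {..a + b}" for i j
    proof -
      obtain m where "m \<le> a + b" "s m = (i, j)" using ij by (metis imageE atMost_iff)
      thus ?thesis using strip(1) unfolding strip_prefix_def by (metis fst_conv snd_conv)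
    qed
    have \<alpha>M: "\<alpha> i < M" if "i \<le> a" for i
      using strictly_increasing_lift[of "Suc a" \<alpha> i a] \<alpha> strip(2) that by (cases "i = a") auto
    have \<beta>M: "\<beta> j < M" if "j \<le> b" for j
      using strictly_increasing_lift[of "Suc b" \<beta> j b] \<beta> strip(3) that by (cases "j = b") auto
    have step: "f i < f (Suc i) \<and> c (f i) (f (Suc i)) = col" if "Suc i < n" for i
    proof -
      consider "i < a" | "i = a" | "a < i" by linarith
      thus ?thesis
      proof cases
        case 1
        thus ?thesis using \<alpha> by (simp add: f_def)
      next
        case 2
        \<comment> \<open>The polygon side between the two arcs is the final cell of the
          staircase.\<close>
        have "(a, b) \<in> s ` {..a + b}" using s(2) by force
        thus ?thesis using 2 cell[of a b] \<alpha>M[of a] \<beta>M[of b] by (simp add: f_def R_def)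
      next
        case 3
        define j where "j = a + b - i"
        have j: "j < b" "a + b + 1 - i = Suc j" "a + b + 1 - Suc i = j"
          using 3 that n by (auto simp: j_def)
        have "f i = R (\<beta> (Suc j))" "f (Suc i) = R (\<beta> j)" using 3 j by (simp_all add: f_def)
        thus ?thesis using \<beta>[OF j(1)] \<beta>M[of j] \<beta>M[of "Suc j"] j by (auto simp: R_def)
      qed
    qed
    have "f i < f j" if "i < j" "j < n" for i j
      using strictly_increasing_lift[of n f i j] step that by auto
    \<comment> \<open>The instance at 0 yields \<open>M > 0\<close>, which
      \<open>R x < 2 * M\<close> requires under truncated subtraction.\<close>
    moreover have "f i < 2 * M" if "i < n" for i
      using \<alpha>M[of i] \<alpha>M[of 0] by (auto simp: f_def R_def)
    moreover have "c (f i) (f j) = col" if "i < j" "j < n" "strip_edge a b s i j" for i j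
    proof (cases "j = Suc i")
      case True
      thus ?thesis using step that by auto
    next
      case False
      thus ?thesis using that cell by (auto simp: strip_edge_def f_def)
    qed
    ultimately show ?thesis by blast
  qed
qed

section \<open>The Ramsey bound\<close>

lemma convex_ramsey_le:
  assumes "convex_ramsey_prop V E N" "N \<le> K"
  shows "convex_ramsey V E \<le> enat K"
proof -
  have "convex_ramsey V E \<le> enat N"
    unfolding convex_ramsey_def using assms(1) by (intro INF_lower) auto
  thus ?thesis using assms(2) by (meson enat_ord_simps(1) order_trans)
qed

text \<open>The increasing map \<open>f\<close> preserves and reflects interleaving, so the strip
  remains free of crossings on the chosen points, and the subgraph inherits this through
  \<open>g\<close>.\<close>

lemma convex_ramsey_prop_strip_subgraph:
  assumes G: "simple_graph V E" and sub: "subgraph_of V E V' E'"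
    and layout: "strip_layout V' E' h a b s" and n: "n = a + b + 2"
  shows "convex_ramsey_prop V E (4 * n ^ 2)"
  unfolding convex_ramsey_prop_def
proof (intro allI impI)
  fix P and c :: "point set \<Rightarrow> bool"
  assume P: "convex_position P" "card P = 4 * n ^ 2"
  obtain g where g: "inj_on g V" "g ` V \<subseteq> V'" "\<And>e. e \<in> E \<Longrightarrow> g ` e \<in> E'"
    using sub unfolding subgraph_of_def by blast
  have s: "staircase (a + b) s" "s (a + b) = (a, b)" and h: "bij_betw h V' {..<n}"
    and strip: "\<And>x y. {x, y} \<in> E' \<Longrightarrow> h x < h y \<Longrightarrow> strip_edge a b s (h x) (h y)"
    using layout n by (auto simp: strip_layout_def)
  \<comment> \<open>Each arc gets \<open>M\<close> points. Since \<open>a + b = n - 2\<close>, the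
    counting argument asks for \<open>2 * (n - 2) * (n - 1) < M\<close>.\<close>
  define M where "M = 2 * n ^ 2"
  have NM: "4 * n ^ 2 = 2 * M" by (simp add: M_def)
  have M: "2 * (a + b) * (n - 1) < M"
    unfolding M_def n power2_eq_square by (simp add: algebra_simps)
  have "P \<noteq> {}" using P n by auto
  then obtain p where o: "ccw_order (2 * M) p" and p: "bij_betw p {..<2 * M} P"
    using convex_position_imp_ccw_order[OF P(1)] P(2) NM by auto
  obtain f col where f: "\<And>i j. i < j \<Longrightarrow> j < n \<Longrightarrow> f i < f j" "\<And>i. i < n \<Longrightarrow> f i < 2 * M"
    "\<And>i j. i < j \<Longrightarrow> j < n \<Longrightarrow> strip_edge a b s i j \<Longrightarrow> c {p (f i), p (f j)} = col"
    using monochromatic_strip[OF s n M, of "\<lambda>i j. c {p i, p j}"] by blast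
  define k where "k v = h (g v)" for v
  have k_less: "k v < n" if "v \<in> V" for v using that g(2) h by (auto simp: k_def bij_betw_def)
  have "inj_on (h \<circ> g) V" using g(1,2) h by (meson bij_betw_def comp_inj_on inj_on_subset)
  hence k_inj: "inj_on k V" by (simp add: k_def[abs_def] comp_def)
  have f_iff: "f i < f j \<longleftrightarrow> i < j" if "i < n" "j < n" for i j
    using f(1)[of i j] f(1)[of j i] that by (cases rule: linorder_cases[of i j]) auto
  have k_strip: "strip_edge a b s (k x) (k y)" if "{x, y} \<in> E" "k x < k y" for x y
    using g(3)[OF that(1)] that(2) strip unfolding k_def by auto
  have edge: "x \<in> V \<and> y \<in> V" if "{x, y} \<in> E" for x y
    using G that unfolding simple_graph_def by (metis doubleton_eq_iff)
  have "inj_on (\<lambda>v. f (k v)) V"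
  proof (rule inj_onI)
    fix x y assume xy: "x \<in> V" "y \<in> V" "f (k x) = f (k y)"
    hence "k x = k y" using f(1)[of "k x" "k y"] f(1)[of "k y" "k x"] k_less
      by (cases rule: linorder_cases[of "k x" "k y"]) auto
    thus "x = y" using k_inj xy by (auto dest: inj_onD)
  qed
  moreover have "(\<lambda>v. f (k v)) ` V \<subseteq> {..<2 * M}" using f(2) k_less by auto
  moreover have "index_noncrossing (\<lambda>v. f (k v)) E"
    unfolding index_noncrossing_def
  proof (intro allI impI notI)
    fix x y u w assume e: "{x, y} \<in> E" "{u, w} \<in> E"
      and "f (k x) < f (k u) \<and> f (k u) < f (k y) \<and> f (k y) < f (k w)"
    hence "k x < k u" "k u < k y" "k y < k w" "k w < n"
      using edge[OF e(1)] edge[OF e(2)] k_less by (auto simp: f_iff)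
    thus False
      using strip_edges_noncrossing[OF s(1) k_strip[OF e(1)] k_strip[OF e(2)]] n by auto
  qed
  ultimately have "noncrossing_embedding (\<lambda>v. p (f (k v))) V E"
    using noncrossing_embedding_iff[OF o bij_betw_imp_inj_on[OF p] G, of "\<lambda>v. f (k v)" "\<lambda>v. p (f (k v))"]
    by blast
  moreover have "(\<lambda>v. p (f (k v))) ` V \<subseteq> P"
    using p f(2) k_less by (auto simp: bij_betw_def)
  moreover have "c ((\<lambda>v. p (f (k v))) ` e) = col" if e: "e \<in> E" for e
  proof -
    obtain x y where xy: "e = {x, y}" "x \<noteq> y" "x \<in> V" "y \<in> V"
      using G e unfolding simple_graph_def by metis
    have "k x \<noteq> k y" using xy k_inj by (auto dest: inj_onD)
    moreover have "c {p (f (k x)), p (f (k y))} = col" if "k x < k y" "{x, y} \<in> E" "y \<in> V" for x y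
      using that by (intro f(3) k_strip k_less)
    ultimately have "c {p (f (k x)), p (f (k y))} = col"
      using xy e by (metis insert_commute linorder_neqE_nat)
    thus ?thesis by (simp add: xy(1))
  qed
  ultimately show "mono_noncrossing_copy V E P c"
    unfolding mono_noncrossing_copy_def
    by (intro exI[of _ "\<lambda>v. p (f (k v))"] exI[of _ col] conjI ballI)
qed

text \<open>Covers \<open>n = 1\<close> separately, because a strip has at least two
  vertices.\<close>

lemma convex_ramsey_prop_trivial:
  assumes G: "simple_graph V E" and "card V \<le> 1"
  shows "convex_ramsey_prop V E 1"
  unfolding convex_ramsey_prop_def
proof (intro allI impI)
  fix P c assume "convex_position P" "card P = 1"
  then obtain q where "P = {q}" by (auto simp: card_1_singleton_iff)
  have eq: "x = y" if "x \<in> V" "y \<in> V" for x y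
    using that assms card_le_Suc0_iff_eq[of V] by (auto simp: simple_graph_def)
  hence "E = {}" using G by (auto simp: simple_graph_def)
  thus "mono_noncrossing_copy V E P c"
    unfolding mono_noncrossing_copy_def noncrossing_embedding_def
    using eq \<open>P = {q}\<close> by (intro exI[of _ "\<lambda>_. q"]) (auto simp: inj_on_def)
qed

theorem theoremt:
  fixes V :: "'v set" and E :: "'v set set" and n :: nat
  assumes "n \<ge> 1"
    and "simple_graph V E"
    and "\<exists>V' E'. PW2 n (V' :: nat set) E' \<and> subgraph_of V E V' E'"
  shows "convex_ramsey V E \<le> enat (20 * n ^ 7)"
proof -
  obtain V' E' where PW: "PW2 n (V' :: nat set) E'" and sub: "subgraph_of V E V' E'"
    using assms(3) by blast
  show ?thesis
  proof (cases "n = 1")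
    case True
    obtain g where "inj_on g V" "g ` V \<subseteq> V'" using sub by (auto simp: subgraph_of_def)
    moreover have "card V' = 1" using PW True by (simp add: PW2_def)
    ultimately have "card V \<le> 1" by (metis card.infinite card_inj_on_le zero_neq_one)
    thus ?thesis
      using convex_ramsey_prop_trivial[OF assms(2)] True by (intro convex_ramsey_le[of V E 1]) auto
  next
    case False
    hence "n \<ge> 2" using assms(1) by simp
    then obtain h a b s where "n = a + b + 2" "strip_layout V' E' h a b s"
      using PW2_strip_layout[OF PW] by blast
    hence "convex_ramsey_prop V E (4 * n ^ 2)"
      using convex_ramsey_prop_strip_subgraph[OF assms(2) sub] by blast
    moreover have "4 * n ^ 2 \<le> 20 * n ^ 7"
      using assms(1) by (intro mult_mono power_increasing) auto
    ultimately show ?thesis by (rule convex_ramsey_le)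
  qed
qed

end
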